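(* Let $n\ge 2$, $\theta>0$ and $\theta/2<\phi\le\pi/2$. Then $$A(n,\theta,\phi)\le B(n,\omega(\theta,\phi)).$$
   Context: $S^{n-1}$ is the unit sphere in $\mathbb R^n$, $e_n=(0,\dots,0,1)$, $\operatorname{dist}$ is angular distance, and $\mathrm{Cap}(n,\phi)=\{x\in S^{n-1}:\langle x,e_n\rangle\ge\cos\phi\}$. A finite set $C\subset S^{n-1}$ is a $\theta$-code if $\operatorname{dist}(x,y)\ge\theta$ for all distinct $x,y\in C$. $A(n,\theta,\phi)$ is the maximum size of a $\theta$-code contained in $\mathrm{Cap}(n,\phi)$, and $B(n,\theta)=A(n,\theta,\pi/2)$ is the maximum size of a $\theta$-code in the closed hemisphere. The angle $\omega(\theta,\phi)\in[0,\pi]$ is defined by $$\cos\omega(\theta,\phi)=\frac{\cos\theta-\cos^2\phi}{\sin^2\phi}.$$ *)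

theory Defs
  imports "HOL-Analysis.Analysis"
begin

text \<open>
  Euclidean $n$-space is \<^typ>\<open>real ^ 'n\<close> with \<^term>\<open>n = CARD('n)\<close>.  The linear order on the
  index type only serves to name the last coordinate.  Every \<open>n \<ge> 1\<close> is realised by such
  a type, for instance a numeral type.
\<close>

definition e_last :: "real ^ 'n::{finite,linorder}" where
  "e_last = axis (Max UNIV) 1"

definition ang_dist :: "real ^ 'n \<Rightarrow> real ^ 'n \<Rightarrow> real" where
  "ang_dist x y = arccos (x \<bullet> y)"

definition Cap :: "real \<Rightarrow> (real ^ 'n::{finite,linorder}) set" where
  "Cap \<phi> = {x \<in> sphere 0 1. x \<bullet> e_last \<ge> cos \<phi>}"

definition spherical_code :: "real \<Rightarrow> (real ^ 'n) set \<Rightarrow> bool" where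
  "spherical_code \<theta> C \<longleftrightarrow>
     finite C \<and> C \<subseteq> sphere 0 1 \<and> (\<forall>x\<in>C. \<forall>y\<in>C. x \<noteq> y \<longrightarrow> ang_dist x y \<ge> \<theta>)"

text \<open>
  For \<open>\<theta> > 0\<close> the set of code sizes is finite, by compactness of the sphere, and it contains
  \<open>0\<close>, so the maximum below exists.  The type argument carries the dimension.
\<close>

definition A :: "'n::{finite,linorder} itself \<Rightarrow> real \<Rightarrow> real \<Rightarrow> nat" where
  "A _ \<theta> \<phi> = Max {card C | C :: (real ^ 'n::{finite,linorder}) set. spherical_code \<theta> C \<and> C \<subseteq> Cap \<phi>}"

definition B :: "'n::{finite,linorder} itself \<Rightarrow> real \<Rightarrow> nat" where
  "B N \<theta> = A N \<theta> (pi / 2)"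

text \<open>
  \<^const>\<open>arccos\<close> returns the angle in \<open>[0, \<pi>]\<close>; its argument lies in \<open>[-1, 1)\<close> whenever
  \<open>0 < \<theta>\<close> and \<open>\<theta> / 2 < \<phi> \<le> \<pi> / 2\<close>.
\<close>

definition \<omega> :: "real \<Rightarrow> real \<Rightarrow> real" where
  "\<omega> \<theta> \<phi> = arccos ((cos \<theta> - (cos \<phi>)\<^sup>2) / (sin \<phi>)\<^sup>2)"

end

theory Submission
  imports Defs
begin

text \<open>
  Stretch the cap onto the hemisphere: divide the component of a point orthogonal to \<open>e\<^sub>n\<close> by
  \<open>s = sin \<phi>\<close>, and choose the new height so that the image is a unit vector.  With
  \<open>c = cos \<phi>\<close>, a point of height \<open>h \<ge> c\<close> gets height \<open>sqrt (h\<^sup>2 - c\<^sup>2) / s\<close>, so the image lies in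
  the closed hemisphere.

  For points \<open>x, y\<close> of heights \<open>h, k\<close>, the inner product of the images is
  \<open>(x \<bullet> y - h k + sqrt ((h\<^sup>2 - c\<^sup>2) (k\<^sup>2 - c\<^sup>2))) / s\<^sup>2\<close>.  The reverse Cauchy-Schwarz
  inequality, \<open>sqrt ((h\<^sup>2 - c\<^sup>2) (k\<^sup>2 - c\<^sup>2)) \<le> h k - c\<^sup>2\<close>, bounds this by \<open>(x \<bullet> y - c\<^sup>2) / s\<^sup>2\<close>.
  If \<open>x \<bullet> y \<le> cos \<theta>\<close>, the bound is at most \<open>(cos \<theta> - c\<^sup>2) / s\<^sup>2 = cos (\<omega> \<theta> \<phi>) < 1\<close>.  Hence the
  stretch is injective on a \<open>\<theta>\<close>-code in the cap and maps it to an \<open>\<omega> \<theta> \<phi>\<close>-code in the hemisphere.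

  It follows that every size attained by the former codes is attained by the latter.  The
  comparison of the maxima also uses that the sizes of \<open>\<omega> \<theta> \<phi>\<close>-codes are bounded, which is a
  compactness argument.
\<close>

section \<open>Spherical codes\<close>

lemma spherical_code_iff_inner_le:
  assumes "0 \<le> \<theta>" "\<theta> \<le> pi"
  shows "spherical_code \<theta> C \<longleftrightarrow>
    finite C \<and> C \<subseteq> sphere 0 1 \<and> (\<forall>x\<in>C. \<forall>y\<in>C. x \<noteq> y \<longrightarrow> x \<bullet> y \<le> cos \<theta>)"
proof -
  have "\<theta> \<le> arccos (x \<bullet> y) \<longleftrightarrow> x \<bullet> y \<le> cos \<theta>"
    if "x \<in> sphere 0 1" "y \<in> sphere 0 1" for x y :: "real^'n"
  proof -
    have "\<bar>x \<bullet> y\<bar> \<le> 1"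
      using Cauchy_Schwarz_ineq2[of x y] that by simp
    then have "- 1 \<le> x \<bullet> y" "x \<bullet> y \<le> 1"
      by auto
    then show ?thesis
      using cos_mono_le_eq[of "arccos (x \<bullet> y)" \<theta>] assms
      by (simp add: arccos_lbound arccos_ubound)
  qed
  then show ?thesis
    unfolding spherical_code_def ang_dist_def by blast
qed

text \<open>
  Distinct code points have Euclidean distance at least \<open>d = sqrt (2 - 2 cos \<theta>)\<close>, so a ball of
  radius \<open>d / 2\<close> contains at most one of them.  Finitely many such balls cover the sphere, and
  their number bounds the size of every code.
\<close>

lemma finite_card_spherical_codes:
  assumes "0 < \<theta>" "\<theta> \<le> pi"
  shows "finite {card C |C :: (real^'n) set. spherical_code \<theta> C \<and> P C}"
proof -
  define d where "d = sqrt (2 - 2 * cos \<theta>)"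
  have "cos \<theta> < 1"
    using cos_monotone_0_pi[of 0 \<theta>] assms by simp
  then have "d > 0"
    by (simp add: d_def)
  then obtain K :: "(real^'n) set" where K: "finite K" "sphere 0 1 \<subseteq> (\<Union>k\<in>K. ball k (d / 2))"
    using compact_imp_seq_compact[OF compact_sphere, of "0 :: real^'n" 1]
      seq_compact_imp_totally_bounded[of "sphere (0 :: real^'n) 1"]
    by (meson half_gt_zero)
  have "card C \<le> card K" if C: "spherical_code \<theta> C" for C :: "(real^'n) set"
  proof -
    have sub: "C \<subseteq> sphere 0 1"
      using C by (simp add: spherical_code_def)
    then have "\<forall>x\<in>C. \<exists>k\<in>K. dist k x < d / 2"
      using K(2) by fastforce
    then obtain f where f: "f x \<in> K" "dist (f x) x < d / 2" if "x \<in> C" for x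
      by metis
    have "inj_on f C"
    proof (rule inj_onI, rule ccontr)
      fix x y assume xy: "x \<in> C" "y \<in> C" "f x = f y" "x \<noteq> y"
      have "x \<bullet> y \<le> cos \<theta>"
        using C xy assms by (simp add: spherical_code_iff_inner_le)
      moreover have "x \<bullet> x = 1" "y \<bullet> y = 1"
        using sub xy by (auto simp: dot_square_norm)
      ultimately have "2 - 2 * cos \<theta> \<le> (dist x y)\<^sup>2"
        by (simp add: dist_norm power2_norm_eq_inner inner_diff inner_commute)
      then have "d \<le> dist x y"
        unfolding d_def by (intro real_le_lsqrt) auto
      also have "dist x y < d"
        using dist_triangle3[of x y "f x"] f(2)[OF xy(1)] f(2)[OF xy(2)] xy(3) by simp
      finally show False
        by simp
    qed
    then show ?thesis
      using f(1) K(1) by (intro card_inj_on_le[of f]) auto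
  qed
  then have "{card C |C :: (real^'n) set. spherical_code \<theta> C \<and> P C} \<subseteq> {..card K}"
    by auto
  then show ?thesis
    by (rule finite_subset) simp
qed

section \<open>Stretching a cap onto the hemisphere\<close>

definition cap_stretch :: "'a::real_inner \<Rightarrow> real \<Rightarrow> 'a \<Rightarrow> 'a" where
  "cap_stretch e \<phi> x =
     (1 / sin \<phi>) *\<^sub>R (x - (x \<bullet> e) *\<^sub>R e + sqrt ((x \<bullet> e)\<^sup>2 - (cos \<phi>)\<^sup>2) *\<^sub>R e)"

lemma inner_cap_stretch_pole:
  assumes "norm e = 1"
  shows "cap_stretch e \<phi> x \<bullet> e = sqrt ((x \<bullet> e)\<^sup>2 - (cos \<phi>)\<^sup>2) / sin \<phi>"
  using assms by (simp add: cap_stretch_def inner_diff_left inner_add_left dot_square_norm)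

lemma inner_cap_stretch:
  assumes "norm e = 1"
  shows "cap_stretch e \<phi> x \<bullet> cap_stretch e \<phi> y =
    (x \<bullet> y - (x \<bullet> e) * (y \<bullet> e) +
      sqrt ((x \<bullet> e)\<^sup>2 - (cos \<phi>)\<^sup>2) * sqrt ((y \<bullet> e)\<^sup>2 - (cos \<phi>)\<^sup>2)) / (sin \<phi>)\<^sup>2"
proof -
  have e: "e \<bullet> e = 1"
    using assms by (simp add: dot_square_norm)
  show ?thesis
    unfolding cap_stretch_def
    by (simp add: inner_diff_left inner_diff_right inner_add_left inner_add_right e
        inner_commute[of e x] inner_commute[of e y] power2_eq_square algebra_simps
        add_divide_distrib diff_divide_distrib)
qed

lemma norm_cap_stretch:
  assumes "norm e = 1" "norm x = 1" "0 \<le> cos \<phi>" "cos \<phi> \<le> x \<bullet> e" "sin \<phi> \<noteq> 0"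
  shows "norm (cap_stretch e \<phi> x) = 1"
proof -
  have "(cos \<phi>)\<^sup>2 \<le> (x \<bullet> e)\<^sup>2"
    using assms by (intro power_mono)
  then have "cap_stretch e \<phi> x \<bullet> cap_stretch e \<phi> x = (1 - (cos \<phi>)\<^sup>2) / (sin \<phi>)\<^sup>2"
    unfolding inner_cap_stretch[OF assms(1)] using assms(2)
    by (simp add: dot_square_norm power2_eq_square)
  also have "\<dots> = 1"
    using assms(5) by (simp add: sin_squared_eq[symmetric])
  finally show ?thesis
    by (simp add: norm_eq_1)
qed

text \<open>
  The reverse Cauchy-Schwarz inequality for the Lorentzian form \<open>h k - c d\<close> on the future causal
  vectors \<open>(h, c)\<close> and \<open>(k, d)\<close>, in the case \<open>d = c\<close>.  The squares of the two sides differ by \<open>c\<^sup>2 (h - k)\<^sup>2\<close>.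
\<close>

lemma sqrt_diff_squares_mult_le:
  fixes c h k :: real
  assumes "0 \<le> c" "c \<le> h" "c \<le> k"
  shows "sqrt (h\<^sup>2 - c\<^sup>2) * sqrt (k\<^sup>2 - c\<^sup>2) \<le> h * k - c\<^sup>2"
proof -
  have "c * c \<le> h * k"
    using assms by (intro mult_mono) auto
  moreover have "(h * k - c\<^sup>2)\<^sup>2 - (h\<^sup>2 - c\<^sup>2) * (k\<^sup>2 - c\<^sup>2) = (c * (h - k))\<^sup>2"
    by (simp add: power2_eq_square algebra_simps)
  then have "(h\<^sup>2 - c\<^sup>2) * (k\<^sup>2 - c\<^sup>2) \<le> (h * k - c\<^sup>2)\<^sup>2"
    using zero_le_power2[of "c * (h - k)"] by linarith
  ultimately show ?thesis
    unfolding real_sqrt_mult[symmetric] by (intro real_le_lsqrt) (auto simp: power2_eq_square)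
qed

lemma inner_cap_stretch_le:
  assumes "norm e = 1" "0 \<le> cos \<phi>" "cos \<phi> \<le> x \<bullet> e" "cos \<phi> \<le> y \<bullet> e"
  shows "cap_stretch e \<phi> x \<bullet> cap_stretch e \<phi> y \<le> (x \<bullet> y - (cos \<phi>)\<^sup>2) / (sin \<phi>)\<^sup>2"
  unfolding inner_cap_stretch[OF assms(1)]
  using sqrt_diff_squares_mult_le[OF assms(2-4)] by (intro divide_right_mono) auto

section \<open>Comparison of caps and hemispheres\<close>

text \<open>
  These bounds make \<open>cos (\<omega> \<theta> \<phi>)\<close> equal to the quotient and \<open>\<omega> \<theta> \<phi>\<close> positive.  The lower one
  holds because \<open>\<theta> < 2 \<phi>\<close> and \<open>cos (2 \<phi>) = (cos \<phi>)\<^sup>2 - (sin \<phi>)\<^sup>2\<close>.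
\<close>

lemma cos_\<omega>_bounds:
  assumes "0 < \<theta>" "\<theta> / 2 < \<phi>" "\<phi> \<le> pi / 2"
  shows "- 1 < (cos \<theta> - (cos \<phi>)\<^sup>2) / (sin \<phi>)\<^sup>2" "(cos \<theta> - (cos \<phi>)\<^sup>2) / (sin \<phi>)\<^sup>2 < 1"
proof -
  have "0 < sin \<phi>"
    using assms by (intro sin_gt_zero) auto
  then have s: "0 < (sin \<phi>)\<^sup>2"
    by simp
  have "cos (2 * \<phi>) < cos \<theta>"
    using assms by (intro cos_monotone_0_pi) auto
  then show "- 1 < (cos \<theta> - (cos \<phi>)\<^sup>2) / (sin \<phi>)\<^sup>2"
    using s by (simp add: pos_less_divide_eq cos_double)
  have "cos \<theta> < cos 0"
    using assms by (intro cos_monotone_0_pi) auto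
  then show "(cos \<theta> - (cos \<phi>)\<^sup>2) / (sin \<phi>)\<^sup>2 < 1"
    using s by (simp add: pos_divide_less_eq sin_squared_eq)
qed

lemma spherical_code_cap_stretch:
  fixes C :: "(real^'n::{finite,linorder}) set"
  assumes ang: "0 < \<theta>" "\<theta> / 2 < \<phi>" "\<phi> \<le> pi / 2"
    and C: "spherical_code \<theta> C" "C \<subseteq> Cap \<phi>"
  defines "T \<equiv> cap_stretch e_last \<phi>"
  shows "inj_on T C" "spherical_code (\<omega> \<theta> \<phi>) (T ` C)" "T ` C \<subseteq> Cap (pi / 2)"
proof -
  note bounds = cos_\<omega>_bounds[OF ang]
  have e: "norm (e_last :: real^'n::{finite,linorder}) = 1"
    by (simp add: e_last_def)
  have c: "0 \<le> cos \<phi>"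
    using ang by (intro cos_ge_zero) auto
  have s: "0 < sin \<phi>"
    using ang by (intro sin_gt_zero) auto
  have cos_\<omega>: "cos (\<omega> \<theta> \<phi>) = (cos \<theta> - (cos \<phi>)\<^sup>2) / (sin \<phi>)\<^sup>2"
    unfolding \<omega>_def using bounds by (intro cos_arccos) auto
  have \<omega>: "0 \<le> \<omega> \<theta> \<phi>" "\<omega> \<theta> \<phi> \<le> pi"
    unfolding \<omega>_def using bounds by (auto intro: arccos_lbound arccos_ubound)
  have unit: "norm x = 1" and height: "cos \<phi> \<le> x \<bullet> e_last" if "x \<in> C" for x
    using that C(2) by (auto simp: Cap_def)
  have norm_T: "norm (T x) = 1" if "x \<in> C" for x
    unfolding T_def using e c s unit[OF that] height[OF that] by (intro norm_cap_stretch) auto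
  have inner_T: "T x \<bullet> T y \<le> cos (\<omega> \<theta> \<phi>)" if xy: "x \<in> C" "y \<in> C" "x \<noteq> y" for x y
  proof -
    have "T x \<bullet> T y \<le> (x \<bullet> y - (cos \<phi>)\<^sup>2) / (sin \<phi>)\<^sup>2"
      unfolding T_def by (rule inner_cap_stretch_le[OF e c height[OF xy(1)] height[OF xy(2)]])
    also have "x \<bullet> y \<le> cos \<theta>"
      using C(1) ang xy by (simp add: spherical_code_iff_inner_le)
    then have "(x \<bullet> y - (cos \<phi>)\<^sup>2) / (sin \<phi>)\<^sup>2 \<le> cos (\<omega> \<theta> \<phi>)"
      unfolding cos_\<omega> by (intro divide_right_mono) auto
    finally show ?thesis .
  qed
  show "inj_on T C"
  proof (rule inj_onI, rule ccontr)
    fix x y assume xy: "x \<in> C" "y \<in> C" "T x = T y" "x \<noteq> y"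
    \<comment> \<open>If the unit vectors \<open>T x\<close> and \<open>T y\<close> coincided, their inner product would be \<open>1\<close>.\<close>
    then show False
      using inner_T[OF xy(1,2,4)] bounds(2) norm_T[OF xy(2)] by (simp add: cos_\<omega> dot_square_norm)
  qed
  show "spherical_code (\<omega> \<theta> \<phi>) (T ` C)"
    using C(1) norm_T inner_T unfolding spherical_code_iff_inner_le[OF \<omega>]
    by (fastforce simp: spherical_code_def)
  have "0 \<le> T x \<bullet> e_last" if "x \<in> C" for x
  proof -
    have "(cos \<phi>)\<^sup>2 \<le> (x \<bullet> e_last)\<^sup>2"
      using c height[OF that] by (intro power_mono)
    then show ?thesis
      unfolding T_def inner_cap_stretch_pole[OF e] using s by simp
  qed
  then show "T ` C \<subseteq> Cap (pi / 2)"
    using norm_T by (auto simp: Cap_def)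
qed

theorem theorem6:
  fixes \<theta> \<phi> :: real
  assumes "CARD('n::{finite,linorder}) \<ge> 2"
    and "\<theta> > 0"
    and "\<theta> / 2 < \<phi>"
    and "\<phi> \<le> pi / 2"
  shows "A TYPE('n) \<theta> \<phi> \<le> B TYPE('n) (\<omega> \<theta> \<phi>)"
  unfolding B_def A_def
proof (rule Max_mono)
  note ang = assms(2-4)
  show "{card C |C :: (real^'n::{finite,linorder}) set. spherical_code \<theta> C \<and> C \<subseteq> Cap \<phi>}
    \<subseteq> {card C |C :: (real^'n::{finite,linorder}) set. spherical_code (\<omega> \<theta> \<phi>) C \<and> C \<subseteq> Cap (pi / 2)}"
  proof clarify
    fix C :: "(real^'n::{finite,linorder}) set"
    assume C: "spherical_code \<theta> C" "C \<subseteq> Cap \<phi>"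
    note T = spherical_code_cap_stretch[OF ang C]
    show "\<exists>D :: (real^'n::{finite,linorder}) set.
        card C = card D \<and> spherical_code (\<omega> \<theta> \<phi>) D \<and> D \<subseteq> Cap (pi / 2)"
      by (rule exI[of _ "cap_stretch e_last \<phi> ` C"]) (simp add: T card_image)
  qed
  have "spherical_code \<theta> ({} :: (real^'n::{finite,linorder}) set)"
    by (simp add: spherical_code_def)
  then show "{card C |C :: (real^'n::{finite,linorder}) set. spherical_code \<theta> C \<and> C \<subseteq> Cap \<phi>} \<noteq> {}"
    by blast
  have "0 < \<omega> \<theta> \<phi>" "\<omega> \<theta> \<phi> \<le> pi"
    unfolding \<omega>_def using arccos_lt_bounded[OF cos_\<omega>_bounds[OF ang]] by auto
  then show "finite {card C |C :: (real^'n::{finite,linorder}) set.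
      spherical_code (\<omega> \<theta> \<phi>) C \<and> C \<subseteq> Cap (pi / 2)}"
    by (rule finite_card_spherical_codes)
qed

end
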